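(* Let $d\ge 1$ and $K\ge 2$ be integers. For any ordered set $\boldsymbol{A}=\{A_1,\dots,A_K\}\subset\mathbb{R}^{d\times d}$ and any matrix $\mathbb{A}=(\mathbb{A}_{ij})\in\{0,1\}^{K\times K}$, the Markovian jump linear system $$x_n=A_{\sigma(n)}x_{n-1},\qquad x_0\in\mathbb{R}^d,\ n\ge 1,\ \sigma\in\varSigma_{\mathbb{A}}^+,$$ is uniformly exponentially stable if and only if it is robustly periodically stable.
   Context: $\|\cdot\|$ is any fixed vector norm on $\mathbb{R}^d$, and also denotes the induced matrix norm on $\mathbb{R}^{d\times d}$. $\rho(B)$ is the spectral radius of a matrix $B$. $\varSigma_{\mathbb{A}}^+$ is the set of all sequences $\sigma\colon\mathbb{N}=\{1,2,\dots\}\to\{1,\dots,K\}$ with $\mathbb{A}_{\sigma(n)\sigma(n+1)}=1$ for all $n\ge1$. For $n\ge1$, $W_{\mathrm{per}}^n(\mathbb{A})$ is the set of words $w=(w_1,\dots,w_n)\in\{1,\dots,K\}^n$ with $\mathbb{A}_{w_kw_{k+1}}=1$ for $1\le k<n$ and $\mathbb{A}_{w_nw_1}=1$. The system is uniformly exponentially stable if there are constants $C>0$ and $0<\gamma<1$ with $\|A_{\sigma(n)}\cdots A_{\sigma(1)}\|\le C\gamma^n$ for all $n\ge1$ and all $\sigma\in\varSigma_{\mathbb{A}}^+$. The system is robustly periodically stable if there is $\varepsilon>0$ such that whenever an ordered set $\{B_1,\dots,B_K\}\subset\mathbb{R}^{d\times d}$ satisfies $\|A_k-B_k\|<\varepsilon$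 for each $1\le k\le K$, then $\rho(B_{w_n}\cdots B_{w_1})<1$ for every $n\ge1$ and every $w\in W_{\mathrm{per}}^n(\mathbb{A})$. *)

theory Defs
  imports "HOL-Analysis.Analysis"
begin

definition is_vector_norm :: "(real ^ 'd \<Rightarrow> real) \<Rightarrow> bool" where
  "is_vector_norm N \<longleftrightarrow>
     (\<forall>x. 0 \<le> N x) \<and>
     (\<forall>x. N x = 0 \<longleftrightarrow> x = 0) \<and>
     (\<forall>c x. N (c *\<^sub>R x) = \<bar>c\<bar> * N x) \<and>
     (\<forall>x y. N (x + y) \<le> N x + N y)"

definition induced_norm :: "(real ^ 'd \<Rightarrow> real) \<Rightarrow> real ^ 'd ^ 'd \<Rightarrow> real" where
  "induced_norm N M = (SUP x\<in>{x. N x = 1}. N (M *v x))"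

text \<open>A real matrix is regarded as a complex one, so that all its complex eigenvalues count.\<close>

definition complex_spectrum :: "real ^ 'd ^ 'd \<Rightarrow> complex set" where
  "complex_spectrum M =
     {z. \<exists>v :: complex ^ 'd. v \<noteq> 0 \<and> map_matrix complex_of_real M *v v = z *s v}"

definition specrad :: "real ^ 'd ^ 'd \<Rightarrow> real" where
  "specrad M = Max (cmod ` complex_spectrum M)"

text \<open>
  The index set of the matrices, \<open>{1, \<dots>, K}\<close> in the literature, is a finite type \<open>'k\<close> with
  \<open>K = CARD('k)\<close>; an ordered set of matrices is a family \<open>A :: 'k \<Rightarrow> real ^ 'd ^ 'd\<close>, so that
  repetitions are allowed.  Words are lists, and \<open>word_prod A [w\<^sub>1, \<dots>, w\<^sub>n]\<close> is the product
  \<open>A w\<^sub>n ** \<dots> ** A w\<^sub>1\<close>, in this order.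
\<close>

primrec word_prod :: "('k \<Rightarrow> real ^ 'd ^ 'd) \<Rightarrow> 'k list \<Rightarrow> real ^ 'd ^ 'd" where
  "word_prod A [] = mat 1"
| "word_prod A (k # w) = word_prod A w ** A k"

text \<open>Sequences start at index 1: the value \<open>\<sigma> 0\<close> is unconstrained and is never used.\<close>

definition admissible_seqs :: "nat ^ 'k ^ 'k \<Rightarrow> (nat \<Rightarrow> 'k) set" where
  "admissible_seqs T = {\<sigma>. \<forall>n\<ge>1. T $ \<sigma> n $ \<sigma> (n + 1) = 1}"

text \<open>List positions start at 0, so the \<open>k\<close>-th letter of a word is \<open>w ! (k - 1)\<close>.\<close>

definition periodic_words :: "nat ^ 'k ^ 'k \<Rightarrow> nat \<Rightarrow> 'k list set" where
  "periodic_words T n =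
     {w. length w = n \<and>
         (\<forall>k. 1 \<le> k \<and> k < n \<longrightarrow> T $ (w ! (k - 1)) $ (w ! k) = 1) \<and>
         T $ (w ! (n - 1)) $ (w ! 0) = 1}"

definition uniformly_exponentially_stable ::
    "(real ^ 'd \<Rightarrow> real) \<Rightarrow> ('k \<Rightarrow> real ^ 'd ^ 'd) \<Rightarrow> nat ^ 'k ^ 'k \<Rightarrow> bool" where
  "uniformly_exponentially_stable N A T \<longleftrightarrow>
     (\<exists>C \<gamma>. C > 0 \<and> 0 < \<gamma> \<and> \<gamma> < 1 \<and>
        (\<forall>n\<ge>1. \<forall>\<sigma>\<in>admissible_seqs T.
           induced_norm N (word_prod A (map \<sigma> [1..<n+1])) \<le> C * \<gamma> ^ n))"

definition robustly_periodically_stable ::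
    "(real ^ 'd \<Rightarrow> real) \<Rightarrow> ('k \<Rightarrow> real ^ 'd ^ 'd) \<Rightarrow> nat ^ 'k ^ 'k \<Rightarrow> bool" where
  "robustly_periodically_stable N A T \<longleftrightarrow>
     (\<exists>\<epsilon>>0. \<forall>B. (\<forall>k. induced_norm N (A k - B k) < \<epsilon>) \<longrightarrow>
        (\<forall>n\<ge>1. \<forall>w\<in>periodic_words T n. specrad (word_prod B w) < 1))"

end

theory Submission
  imports Defs "HOL-Computational_Algebra.Fundamental_Theorem_Algebra"
begin

text \<open>
  Uniform stability passes to small perturbations by comparing products over blocks of a fixed
  length; a power of a periodic product splits into such blocks, so its eigenvalues lie inside the
  unit disc.

  For the converse only the perturbations \<open>(1 + \<eta>) A\<close> matter: they bound the spectral radii of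
  all periodic products by some \<open>l < 1\<close>. If \<open>r \<le> 1\<close> and the admissible products of \<open>r A\<close> are
  bounded, then \<open>v\<^sub>i x = sup N ((r A)\<^sub>w x)\<close>, over the admissible words \<open>w\<close> starting in state \<open>i\<close>,
  are norms that do not increase along the system. In the coordinates of an Auerbach basis of
  \<open>v\<^sub>i\<close>, a long orbit along which the norm is not halved nearly returns to an earlier point in the
  same state; the periodic product \<open>P\<close> in between then has \<open>det (I - P)\<close> close to \<open>0\<close>,
  contradicting \<open>\<bar>det (I - P)\<bar> \<ge> (1 - l) ^ d\<close>. The length \<open>p\<close> needed for halving is
  independent of \<open>r\<close>, so \<open>r\<close> may be replaced by \<open>r\<close> times the \<open>p\<close>-th root of \<open>2\<close>, and
  finitely many repetitions reach some \<open>r > 1\<close>. No reduction to irreducible systems is needed.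
\<close>

section \<open>Eigenvalues and determinants\<close>

lemma poly_det: "poly (det M) z = det (map_matrix (\<lambda>p. poly p z) M)"
  for M :: "'a::comm_ring_1 poly ^ 'n ^ 'n"
  by (simp add: det_def poly_sum poly_prod)

text \<open>Each Leibniz term is, up to sign, a product of \<open>CARD('n)\<close> entries of degree
  at most one.\<close>

lemma degree_det_le:
  fixes M :: "'a::comm_ring_1 poly ^ 'n ^ 'n"
  assumes "\<And>i j. degree (M $ i $ j) \<le> 1"
  shows "degree (det M) \<le> CARD('n)"
  unfolding det_def
proof (rule degree_sum_le)
  fix p :: "'n \<Rightarrow> 'n"
  have "degree (\<Prod>i\<in>UNIV. M $ i $ p i) \<le> (\<Sum>i\<in>UNIV. degree (M $ i $ p i))"
    using degree_prod_sum_le[of UNIV "\<lambda>i. M $ i $ p i"] by (simp add: o_def)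
  also have "\<dots> \<le> (\<Sum>i\<in>(UNIV::'n set). 1)"
    by (intro sum_mono assms)
  finally have "degree (\<Prod>i\<in>UNIV. M $ i $ p i) \<le> CARD('n)"
    by simp
  then show "degree (of_int (sign p) * (\<Prod>i\<in>UNIV. M $ i $ p i)) \<le> CARD('n)"
    by (cases "sign p = 1") (auto simp: sign_def)
qed simp

lemma det_eq_0_iff_kernel:
  fixes M :: "'a::field ^ 'n ^ 'n"
  shows "det M = 0 \<longleftrightarrow> (\<exists>v. v \<noteq> 0 \<and> M *v v = 0)"
  using matrix_left_invertible_ker[of M] invertible_det_nz[of M] invertible_left_inverse[of M]
  by blast

text \<open>This is det (I - t M), the reversed characteristic polynomial. Its constant term is 1,
  so it is visibly nonzero; its roots are the inverses of the nonzero eigenvalues, and its value at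
  1 is det (I - M).\<close>

definition rev_charpoly :: "real ^ 'd ^ 'd \<Rightarrow> complex poly" where
  "rev_charpoly M = det (\<chi> i j. [: if i = j then 1 else 0, - complex_of_real (M $ i $ j) :])"

lemma poly_rev_charpoly:
  "poly (rev_charpoly M) t = det (mat 1 - map_matrix (\<lambda>a. t * complex_of_real a) M)"
  unfolding rev_charpoly_def poly_det
  by (rule arg_cong[where f = det]) (simp add: vec_eq_iff mat_def)

lemma rev_charpoly_0 [simp]: "poly (rev_charpoly M) 0 = 1"
proof -
  have "mat 1 - map_matrix (\<lambda>a. 0 * complex_of_real a) M = mat 1"
    by (simp add: vec_eq_iff)
  then show ?thesis
    by (simp only: poly_rev_charpoly det_I)
qed

lemma rev_charpoly_nonzero [simp]: "rev_charpoly M \<noteq> 0"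
  using rev_charpoly_0[of M] by (metis poly_0 zero_neq_one)

lemma poly_rev_charpoly_1: "poly (rev_charpoly M) 1 = complex_of_real (det (mat 1 - M))"
  unfolding poly_rev_charpoly det_def
  by (simp add: mat_def of_real_prod cong: if_cong)
     (intro sum.cong refl arg_cong2[where f = "(*)"] prod.cong, auto)

lemma degree_rev_charpoly: "degree (rev_charpoly (M :: real ^ 'd ^ 'd)) \<le> CARD('d)"
  unfolding rev_charpoly_def by (rule degree_det_le) simp

lemma complex_spectrum_iff_det:
  "z \<in> complex_spectrum M \<longleftrightarrow> det (mat z - map_matrix complex_of_real M) = 0"
proof -
  have "(mat z - map_matrix complex_of_real M) *v v = z *s v - map_matrix complex_of_real M *v v" for v
    by (simp add: matrix_vector_mult_diff_rdistrib)
      (simp add: vec_eq_iff matrix_vector_mult_def mat_def if_distrib if_distribR cong: if_cong)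
  then show ?thesis
    by (auto simp: complex_spectrum_def det_eq_0_iff_kernel)
qed

lemma det_scale:
  fixes M :: "'a::comm_ring_1 ^ 'n ^ 'n"
  shows "det (map_matrix ((*) c) M) = c ^ CARD('n) * det M"
  unfolding det_def
  by (simp add: prod.distrib sum_distrib_left algebra_simps)

text \<open>Factoring \<open>z\<close> out of every row of z I - M leaves I - M / z.\<close>

lemma det_mat_minus_eq_rev_charpoly:
  fixes M :: "real ^ 'd ^ 'd"
  assumes "z \<noteq> 0"
  shows "det (mat z - map_matrix complex_of_real M) = z ^ CARD('d) * poly (rev_charpoly M) (inverse z)"
proof -
  have "mat z - map_matrix complex_of_real M
      = map_matrix ((*) z) (mat 1 - map_matrix (\<lambda>a. inverse z * complex_of_real a) M)"
    using assms by (simp add: vec_eq_iff mat_def algebra_simps)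
  then show ?thesis
    by (simp only: det_scale poly_rev_charpoly)
qed

lemma complex_spectrum_iff_rev_charpoly:
  "z \<noteq> 0 \<Longrightarrow> z \<in> complex_spectrum M \<longleftrightarrow> poly (rev_charpoly M) (inverse z) = 0"
  by (simp add: complex_spectrum_iff_det det_mat_minus_eq_rev_charpoly)

text \<open>The nonzero eigenvalues are inverses of roots of a nonzero polynomial. Finiteness and
  nonemptiness together make \<open>Max\<close> in \<open>specrad\<close> a genuine maximum.\<close>

lemma finite_complex_spectrum: "finite (complex_spectrum M)"
proof (rule finite_subset)
  show "complex_spectrum M \<subseteq> insert 0 (inverse ` {t. poly (rev_charpoly M) t = 0})"
  proof
    fix z assume "z \<in> complex_spectrum M"
    then show "z \<in> insert 0 (inverse ` {t. poly (rev_charpoly M) t = 0})"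
      using complex_spectrum_iff_rev_charpoly[of z M] inverse_inverse_eq[of z]
      by (cases "z = 0") (auto intro!: image_eqI[of z inverse "inverse z"])
  qed
  show "finite (insert 0 (inverse ` {t. poly (rev_charpoly M) t = 0}))"
    by (simp add: poly_roots_finite)
qed

text \<open>Without nonzero eigenvalues the reversed characteristic polynomial is the constant \<open>1\<close>, so
  \<open>det (s I - M) = s ^ d\<close> for \<open>s \<noteq> 0\<close>, and by continuity \<open>0\<close> is an eigenvalue.\<close>

lemma complex_spectrum_nonempty:
  fixes M :: "real ^ 'd ^ 'd"
  shows "complex_spectrum M \<noteq> {}"
proof
  assume empty: "complex_spectrum M = {}"
  have "poly (rev_charpoly M) t \<noteq> 0" for t
    using complex_spectrum_iff_rev_charpoly[of "inverse t" M] empty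
    by (cases "t = 0") auto
  then have "constant (poly (rev_charpoly M))"
    using fundamental_theorem_of_algebra by blast
  then have one: "poly (rev_charpoly M) t = 1" for t
    by (metis constant_def rev_charpoly_0)
  let ?h = "\<lambda>s. det (mat s - map_matrix complex_of_real M)"
  have entry: "((\<lambda>s::complex. (mat s :: complex ^ 'd ^ 'd) $ i $ j) \<longlongrightarrow> mat 0 $ i $ j) (at 0)" for i j
    by (cases "i = j") (simp_all add: mat_def)
  have "(?h \<longlongrightarrow> ?h 0) (at 0)"
    by (simp only: det_def vector_minus_component) (intro tendsto_intros entry)
  moreover have "eventually (\<lambda>s. ?h s = s ^ CARD('d)) (at 0)"
    by (simp add: eventually_at_filter det_mat_minus_eq_rev_charpoly one)
  ultimately have "((\<lambda>s. s ^ CARD('d)) \<longlongrightarrow> ?h 0) (at (0::complex))"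
    by (simp add: filterlim_cong)
  moreover have "((\<lambda>s. s ^ CARD('d)) \<longlongrightarrow> 0 ^ CARD('d)) (at (0::complex))"
    by (intro tendsto_intros)
  ultimately have "?h 0 = 0 ^ CARD('d)"
    using tendsto_unique at_neq_bot by blast
  then have "0 \<in> complex_spectrum M"
    by (simp add: complex_spectrum_iff_det)
  then show False
    using empty by simp
qed

lemma specrad_less_iff: "specrad M < r \<longleftrightarrow> (\<forall>z\<in>complex_spectrum M. cmod z < r)"
  unfolding specrad_def using finite_complex_spectrum[of M] complex_spectrum_nonempty[of M]
  by (subst Max_less_iff) auto

lemma complex_spectrum_scaleR:
  assumes "z \<in> complex_spectrum M"
  shows "of_real c * z \<in> complex_spectrum (c *\<^sub>R M)"
proof -
  obtain v where v: "v \<noteq> 0" "map_matrix complex_of_real M *v v = z *s v"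
    using assms by (auto simp: complex_spectrum_def)
  have "map_matrix complex_of_real (c *\<^sub>R M) *v v = of_real c *s (map_matrix complex_of_real M *v v)"
    by (simp add: vec_eq_iff matrix_vector_mult_def sum_distrib_left mult.assoc)
  then show ?thesis
    using v by (auto simp: complex_spectrum_def)
qed

text \<open>Over the complex numbers, det (I - M) is the product of 1 - z over the nonzero
  eigenvalues z with multiplicity, and each factor has modulus at least 1 - l.\<close>

lemma det_mat_1_minus_ge:
  fixes M :: "real ^ 'd ^ 'd"
  assumes spec: "\<And>z. z \<in> complex_spectrum M \<Longrightarrow> cmod z \<le> l" and l: "0 \<le> l" "l < 1"
  shows "(1 - l) ^ CARD('d) \<le> \<bar>det (mat 1 - M)\<bar>"
proof -
  let ?f = "rev_charpoly M" and ?n = "degree (rev_charpoly M)"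
  obtain root where root: "smult (lead_coeff ?f) (\<Prod>i<?n. [:- root i, 1:]) = ?f"
    using complex_poly_decompose'[of ?f] by blast
  have poly_f: "poly ?f t = lead_coeff ?f * (\<Prod>i<?n. t - root i)" for t
    by (subst root[symmetric]) (simp add: poly_prod)
  have is_root: "poly ?f (root i) = 0" if "i < ?n" for i
    using that by (auto simp: poly_f)
  then have root_nz: "root i \<noteq> 0" if "i < ?n" for i
    using that rev_charpoly_0[of M] by fastforce
  have factor: "1 - l \<le> cmod ((1 - root i) / (0 - root i))" if i: "i < ?n" for i
  proof -
    have "inverse (root i) \<in> complex_spectrum M"
      using complex_spectrum_iff_rev_charpoly[of "inverse (root i)" M] root_nz[OF i] is_root[OF i]
      by simp
    then have "cmod (inverse (root i)) \<le> l"
      by (rule spec)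
    then have "1 - l \<le> cmod 1 - cmod (inverse (root i))"
      by simp
    also have "\<dots> \<le> cmod (1 - inverse (root i))"
      by (rule norm_triangle_ineq2)
    also have "1 - inverse (root i) = (1 - root i) / (0 - root i)"
      using root_nz[OF i] by (simp add: field_simps)
    finally show ?thesis .
  qed
  \<comment> \<open>The degree falls below \<open>CARD('d)\<close> when 0 is an eigenvalue; the
    absent factors do no harm because 0 < 1 - l \<le> 1.\<close>
  have "(1 - l) ^ CARD('d) \<le> (1 - l) ^ ?n"
    using l degree_rev_charpoly[of M] by (intro power_decreasing) auto
  also have "\<dots> \<le> (\<Prod>i<?n. cmod ((1 - root i) / (0 - root i)))"
    using prod_mono[of "{..<?n}" "\<lambda>_. 1 - l" "\<lambda>i. cmod ((1 - root i) / (0 - root i))"] factor l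
    by simp
  \<comment> \<open>The quotient cancels the leading coefficient, and its denominator is 1.\<close>
  also have "\<dots> = cmod (poly ?f 1 / poly ?f 0)"
    by (simp only: prod_norm prod_dividef poly_f mult_divide_mult_cancel_left leading_coeff_0_iff
        rev_charpoly_nonzero not_False_eq_True)
  also have "\<dots> = \<bar>det (mat 1 - M)\<bar>"
    by (simp add: poly_rev_charpoly_1)
  finally show ?thesis .
qed

text \<open>Every Leibniz term meets each column exactly once. With a separate bound per column, a
  single small column makes the whole determinant small.\<close>

lemma abs_det_le:
  fixes M :: "real ^ 'd ^ 'd"
  assumes "\<And>i j. \<bar>M $ i $ j\<bar> \<le> b j"
  shows "\<bar>det M\<bar> \<le> fact CARD('d) * (\<Prod>j\<in>UNIV. b j)"
proof -
  have "\<bar>det M\<bar> \<le> (\<Sum>p\<in>{p. p permutes (UNIV::'d set)}. \<Prod>j\<in>UNIV. b j)"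
    unfolding det_def
  proof (intro order_trans[OF sum_abs] sum_mono)
    fix p assume "p \<in> {p. p permutes (UNIV::'d set)}"
    then have p: "p permutes UNIV" by simp
    have "\<bar>of_int (sign p) * (\<Prod>i\<in>UNIV. M $ i $ p i)\<bar> = (\<Prod>i\<in>UNIV. \<bar>M $ i $ p i\<bar>)"
      by (simp add: abs_mult abs_prod sign_def)
    also have "\<dots> \<le> (\<Prod>i\<in>UNIV. b (p i))"
      by (intro prod_mono) (auto intro: assms)
    also have "\<dots> = (\<Prod>j\<in>UNIV. b j)"
      by (rule prod.permute[OF p, of b, symmetric, unfolded o_def])
    finally show "\<bar>of_int (sign p) * (\<Prod>i\<in>UNIV. M $ i $ p i)\<bar> \<le> (\<Prod>j\<in>UNIV. b j)" .
  qed
  then show ?thesis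
    by (simp add: card_permutations)
qed

section \<open>Vector norms\<close>

lemma vector_normD:
  assumes "is_vector_norm N"
  shows "0 \<le> N x" "N x = 0 \<longleftrightarrow> x = 0" "N (c *\<^sub>R x) = \<bar>c\<bar> * N x" "N (x + y) \<le> N x + N y"
  using assms by (auto simp: is_vector_norm_def)

lemma vector_norm_0 [simp]: "is_vector_norm N \<Longrightarrow> N 0 = 0"
  by (simp add: vector_normD)

lemma vector_norm_minus: "is_vector_norm N \<Longrightarrow> N (- x) = N x"
  using vector_normD(3)[of N "-1" x] by simp

lemma vector_norm_diff: "is_vector_norm N \<Longrightarrow> N (x - y) \<le> N x + N y"
  using vector_normD(4)[of N x "- y"] by (simp add: vector_norm_minus)

lemma vector_norm_sum_le:
  assumes "is_vector_norm N"
  shows "N (\<Sum>i\<in>I. f i) \<le> (\<Sum>i\<in>I. N (f i))"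
proof (induction I rule: infinite_finite_induct)
  case (insert i I)
  then show ?case
    using vector_normD(4)[OF assms, of "f i" "sum f I"] by simp
qed (use assms in auto)

lemma vector_norm_le_sum:
  assumes "is_vector_norm N"
  shows "N (M *v x) \<le> (\<Sum>i\<in>UNIV. \<bar>x $ i\<bar> * N (column i M))"
proof -
  have "N (M *v x) = N (\<Sum>i\<in>UNIV. (x $ i) *\<^sub>R column i M)"
    by (simp add: matrix_mult_sum scalar_mult_eq_scaleR)
  also have "\<dots> \<le> (\<Sum>i\<in>UNIV. N ((x $ i) *\<^sub>R column i M))"
    by (rule vector_norm_sum_le[OF assms])
  finally show ?thesis
    by (simp add: vector_normD(3)[OF assms])
qed

lemma vector_norm_le_norm:
  assumes "is_vector_norm N"
  obtains b where "b > 0" "\<And>x. N x \<le> b * norm x"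
proof
  let ?b = "\<Sum>i\<in>UNIV. N (column i (mat 1))"
  have nonneg: "0 \<le> ?b"
    by (intro sum_nonneg vector_normD(1)[OF assms])
  then show "?b + 1 > 0" by simp
  fix x
  have "N x \<le> (\<Sum>i\<in>UNIV. \<bar>x $ i\<bar> * N (column i (mat 1)))"
    using vector_norm_le_sum[OF assms, of "mat 1" x] by simp
  also have "\<dots> \<le> (\<Sum>i\<in>UNIV. norm x * N (column i (mat 1)))"
    by (intro sum_mono mult_right_mono component_le_norm_cart vector_normD(1)[OF assms])
  also have "\<dots> \<le> (?b + 1) * norm x"
    by (simp add: sum_distrib_left[symmetric] algebra_simps)
  finally show "N x \<le> (?b + 1) * norm x" .
qed

lemma continuous_on_vector_norm:
  assumes "is_vector_norm N"
  shows "continuous_on S N"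
proof -
  obtain b where b: "b > 0" "\<And>x. N x \<le> b * norm x"
    using vector_norm_le_norm[OF assms] by blast
  have "\<bar>N x - N y\<bar> \<le> b * norm (x - y)" for x y
  proof -
    have "N x \<le> N y + N (x - y)" "N y \<le> N x + N (x - y)"
      using vector_normD(4)[OF assms, of y "x - y"] vector_norm_diff[OF assms, of x "x - y"] by simp_all
    then show ?thesis
      using b(2)[of "x - y"] by linarith
  qed
  then have "b-lipschitz_on S N"
    using b(1) by (intro lipschitz_onI) (auto simp: dist_norm)
  then show ?thesis
    by (rule lipschitz_on_continuous_on)
qed

text \<open>By compactness \<open>N\<close> attains a minimum on the Euclidean unit sphere; it is
  positive, and homogeneity carries the estimate to all vectors.\<close>

lemma norm_le_vector_norm:
  assumes "is_vector_norm N"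
  obtains a where "a > 0" "\<And>x. norm x \<le> a * N x"
proof -
  let ?S = "sphere (0::real^'a) 1"
  have ne: "?S \<noteq> {}" by simp
  obtain x0 where x0: "x0 \<in> ?S" "\<And>y. y \<in> ?S \<Longrightarrow> N x0 \<le> N y"
    using continuous_attains_inf[OF compact_sphere ne continuous_on_vector_norm[OF assms]] by blast
  have pos: "N x0 > 0"
    using x0(1) vector_normD(1,2)[OF assms, of x0] by (cases "x0 = 0") auto
  have "norm x \<le> inverse (N x0) * N x" for x
  proof (cases "x = 0")
    case False
    then have "N x0 \<le> N (inverse (norm x) *\<^sub>R x)"
      by (intro x0(2)) simp
    also have "\<dots> = N x / norm x"
      by (simp add: vector_normD(3)[OF assms] field_simps)
    finally show ?thesis
      using pos False by (simp add: field_simps)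
  qed (use assms in simp)
  then show thesis
    using that[of "inverse (N x0)"] pos by simp
qed

text \<open>The columns of \<open>M\<close> form an Auerbach basis; \<open>M'\<close> computes the coordinates in it.\<close>

definition auerbach_basis :: "(real ^ 'd \<Rightarrow> real) \<Rightarrow> real ^ 'd ^ 'd \<Rightarrow> real ^ 'd ^ 'd \<Rightarrow> bool" where
  "auerbach_basis N M M' \<longleftrightarrow> M' ** M = mat 1 \<and> M ** M' = mat 1 \<and>
     (\<forall>j. N (column j M) \<le> 1) \<and> (\<forall>x i. \<bar>(M' *v x) $ i\<bar> \<le> N x)"

text \<open>Maximise the determinant over the matrices with columns in the unit ball.\<close>

lemma auerbach_basis_exists:
  fixes N :: "real ^ 'd \<Rightarrow> real"
  assumes "is_vector_norm N"
  shows "\<exists>M M'. auerbach_basis N M M'"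
proof -
  obtain a where a: "a > 0" "\<And>x. norm x \<le> a * N x"
    using norm_le_vector_norm[OF assms] by blast
  obtain b where b: "b > 0" "\<And>x. N x \<le> b * norm x"
    using vector_norm_le_norm[OF assms] by blast
  define S where "S = {M :: real ^ 'd ^ 'd. \<forall>j. N (column j M) \<le> 1}"
  \<comment> \<open>Towards compactness of \<open>S\<close>: columns in the unit ball of
    \<open>N\<close> have entries of absolute value at most \<open>a\<close>.\<close>
  have "norm M \<le> CARD('d) * (CARD('d) * a)" if "M \<in> S" for M
  proof -
    have entry: "\<bar>M $ i $ j\<bar> \<le> a" for i j
    proof -
      have "\<bar>M $ i $ j\<bar> \<le> norm (column j M)"
        using component_le_norm_cart[of "column j M" i] by (simp add: column_def)
      also have "\<dots> \<le> a * N (column j M)" by (rule a(2))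
      also have "\<dots> \<le> a * 1"
        using that a(1) by (intro mult_left_mono) (auto simp: S_def)
      finally show ?thesis by simp
    qed
    have "norm M \<le> (\<Sum>i\<in>UNIV. norm (M $ i))"
      unfolding norm_vec_def[of M] by (rule L2_set_le_sum) simp
    also have "\<dots> \<le> (\<Sum>i\<in>(UNIV::'d set). \<Sum>j\<in>(UNIV::'d set). a)"
      by (intro sum_mono order_trans[OF norm_le_l1_cart] entry)
    finally show ?thesis by simp
  qed
  then have "bounded S"
    unfolding bounded_iff by blast
  moreover have "closed S"
    unfolding S_def
  proof (intro closed_Collect_all)
    fix j
    have "continuous_on UNIV (\<lambda>M :: real ^ 'd ^ 'd. column j M)"
      unfolding column_def by (intro continuous_intros continuous_on_vec_lambda)
    then show "closed {M :: real ^ 'd ^ 'd. N (column j M) \<le> 1}"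
      by (intro closed_Collect_le continuous_on_const
          continuous_on_compose2[OF continuous_on_vector_norm[OF assms, of UNIV]]) auto
  qed
  ultimately have "compact S"
    by (simp add: compact_eq_bounded_closed)
  \<comment> \<open>A small multiple of the identity lies in \<open>S\<close> and has positive
    determinant, so the maximiser is invertible.\<close>
  moreover have scaled: "mat (inverse b) \<in> S"
  proof -
    have "column j (mat (inverse b)) = inverse b *\<^sub>R axis j 1" for j
      by (auto simp: vec_eq_iff column_def mat_def axis_def)
    then have "N (column j (mat (inverse b))) = inverse b * N (axis j 1)" for j
      using b(1) by (metis vector_normD(3)[OF assms] abs_of_pos inverse_positive_iff_positive)
    moreover have "inverse b * N (axis j 1) \<le> 1" for j
      using b(1) b(2)[of "axis j 1"] by (simp add: norm_axis_1 field_simps)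
    ultimately show ?thesis
      by (simp add: S_def)
  qed
  moreover have "continuous_on S det"
    unfolding det_def by (intro continuous_intros)
  ultimately obtain M where M: "M \<in> S" "\<And>X. X \<in> S \<Longrightarrow> det X \<le> det M"
    using continuous_attains_sup[of S det] by blast
  have "det (mat (inverse b) :: real ^ 'd ^ 'd) = inverse b ^ CARD('d)"
    using det_matrix_scaleR[of "inverse b", where 'n = 'd] by (simp add: matrix_scaleR)
  then have pos: "0 < det M"
    using M(2)[OF scaled] b(1) by (metis inverse_positive_iff_positive less_le_trans zero_less_power)
  then obtain M' where M': "M' ** M = mat 1" "M ** M' = mat 1"
    by (metis invertible_def invertible_det_nz less_irrefl)
  have unit: "N x \<le> 1 \<Longrightarrow> (M' *v x) $ k \<le> 1" for x k
  proof -
    assume "N x \<le> 1"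
    \<comment> \<open>Column \<open>k\<close> is replaced by \<open>x\<close>, which stays in
      \<open>S\<close>. By Cramer's rule the new determinant is the \<open>k\<close>-th coordinate
      of \<open>x\<close> times \<open>det M\<close>, so maximality bounds that coordinate by
      1.\<close>
    let ?X = "\<chi> i j. if j = k then (M *v (M' *v x)) $ i else M $ i $ j"
    have x: "M *v (M' *v x) = x"
      by (simp add: matrix_vector_mul_assoc M')
    have "column j ?X = (if j = k then x else column j M)" for j
      unfolding x by (simp add: vec_eq_iff column_def)
    then have "?X \<in> S"
      using M(1) \<open>N x \<le> 1\<close> by (simp add: S_def)
    from M(2)[OF this] have "(M' *v x) $ k * det M \<le> det M"
      by (simp only: cramer_lemma)
    then show ?thesis
      using pos by simp
  qed
  have coord: "(M' *v x) $ k \<le> N x" for x k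
  proof (cases "x = 0")
    case False
    then have nz: "N x > 0"
      using vector_normD(1,2)[OF assms, of x] by linarith
    then have "(M' *v (inverse (N x) *\<^sub>R x)) $ k \<le> 1"
      by (intro unit) (simp add: vector_normD(3)[OF assms])
    then show ?thesis
      using nz by (simp add: matrix_vector_mult_scaleR field_simps)
  qed (use assms in simp)
  \<comment> \<open>The one-sided bound, used at \<open>x\<close> and at \<open>- x\<close>, bounds
    the absolute value.\<close>
  have neg: "M' *v (- x) = - (M' *v x)" for x
    using matrix_vector_mult_scaleR[of M' "-1" x] by simp
  have "\<bar>(M' *v x) $ i\<bar> \<le> N x" for x i
    using coord[of x i] coord[of "- x" i] by (simp add: neg vector_norm_minus[OF assms])
  then show ?thesis
    using M(1) M' by (auto simp: auerbach_basis_def S_def)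
qed

text \<open>The bound does not depend on the norm, which is what makes the contraction below uniform.\<close>

lemma abs_det_mat_1_minus_le:
  fixes P M M' :: "real ^ 'd ^ 'd" and e :: real
  assumes N: "is_vector_norm N" and contr: "\<And>y. N (P *v y) \<le> N y"
    and basis: "auerbach_basis N M M'"
    and x: "1 / 2 \<le> N x" and e: "\<And>i. \<bar>(M' *v (x - P *v x)) $ i\<bar> \<le> e"
  shows "\<bar>det (mat 1 - P)\<bar> \<le> 2 * CARD('d) * fact CARD('d) * 2 ^ CARD('d) * e"
proof -
  have M: "M' ** M = mat 1" "M ** M' = mat 1" "N (column j M) \<le> 1" "\<bar>(M' *v x) $ i\<bar> \<le> N x" for x i j
    using basis by (auto simp: auerbach_basis_def)
  define y where "y = M' *v x"
  \<comment> \<open>I - P in Auerbach coordinates: the determinant is unchanged, and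
    \<open>e\<close> bounds the entries of \<open>Q *v y\<close>.\<close>
  define Q where "Q = M' ** (mat 1 - P) ** M"
  have detQ: "det Q = det (mat 1 - P)"
  proof -
    have "det M' * det M = 1"
      by (metis M(1) det_I det_mul)
    then show ?thesis
      by (simp add: Q_def det_mul mult.commute mult.left_commute)
  qed
  have Qy: "Q *v y = M' *v (x - P *v x)"
    by (simp add: Q_def y_def matrix_vector_mul_assoc[symmetric] matrix_vector_mult_diff_rdistrib)
       (simp add: matrix_vector_mul_assoc M)
  have e0: "0 \<le> e"
    using order_trans[OF abs_ge_zero e] by blast
  \<comment> \<open>Basis vectors have norm at most 1 and \<open>P\<close> does not increase the
    norm, so I - P sends them to vectors of norm at most 2, which dominates the coordinates.\<close>
  have entry: "\<bar>Q $ i $ j\<bar> \<le> 2" for i j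
  proof -
    let ?m = "column j M"
    have "column j Q = M' *v (?m - P *v ?m)"
      by (simp add: Q_def matrix_vector_mult_basis[symmetric] matrix_vector_mul_assoc[symmetric]
          matrix_vector_mult_diff_rdistrib)
    then have "Q $ i $ j = (M' *v (?m - P *v ?m)) $ i"
      by (simp add: vec_eq_iff column_def)
    then have "\<bar>Q $ i $ j\<bar> \<le> N (?m - P *v ?m)"
      using M(4) by simp
    also have "\<dots> \<le> N ?m + N (P *v ?m)"
      by (rule vector_norm_diff[OF N])
    also have "\<dots> \<le> 2"
      using contr[of ?m] M(3)[of j] by linarith
    finally show ?thesis .
  qed
  have "1 / 2 \<le> N (M *v y)"
    using x by (simp add: y_def matrix_vector_mul_assoc M)
  also have "\<dots> \<le> (\<Sum>i\<in>UNIV. \<bar>y $ i\<bar> * N (column i M))"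
    by (rule vector_norm_le_sum[OF N])
  also have "\<dots> \<le> (\<Sum>i\<in>UNIV. \<bar>y $ i\<bar>)"
    by (intro sum_mono mult_left_le M) simp
  finally have "1 / 2 \<le> (\<Sum>i\<in>UNIV. \<bar>y $ i\<bar>)" .
  \<comment> \<open>Averaging: some coordinate carries at least its share of the total 1 /
    2.\<close>
  then have "\<not> (\<forall>k. \<bar>y $ k\<bar> < 1 / (2 * CARD('d)))"
    using sum_strict_mono[of UNIV "\<lambda>i. \<bar>y $ i\<bar>" "\<lambda>_. 1 / (2 * CARD('d))"] by auto
  then obtain k where k: "1 / (2 * CARD('d)) \<le> \<bar>y $ k\<bar>"
    by (auto simp: not_less)
  \<comment> \<open>Cramer's rule again: one column is the small vector \<open>Q *v y\<close>, while
    the factor \<open>y $ k\<close> is bounded away from 0.\<close>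
  have "y $ k * det Q = det (\<chi> i j. if j = k then (Q *v y) $ i else Q $ i $ j)"
    by (rule cramer_lemma[symmetric])
  also have "\<bar>\<dots>\<bar> \<le> fact CARD('d) * (\<Prod>j\<in>UNIV. if j = k then e else 2)"
    by (rule abs_det_le) (use entry e in \<open>auto simp: Qy\<close>)
  also have "(\<Prod>j\<in>UNIV. if j = k then e else 2) = e * 2 ^ (CARD('d) - 1)"
    by (subst prod.remove[of _ k]) (auto simp: prod.If_cases card_Diff_singleton)
  also have "\<dots> \<le> e * 2 ^ CARD('d)"
    using e0 by (intro mult_left_mono power_increasing) auto
  finally have "\<bar>y $ k\<bar> * \<bar>det Q\<bar> \<le> fact CARD('d) * (e * 2 ^ CARD('d))"
    by (simp add: abs_mult)
  then have "1 / (2 * CARD('d)) * \<bar>det Q\<bar> \<le> fact CARD('d) * (e * 2 ^ CARD('d))"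
    using mult_right_mono[OF k, of "\<bar>det Q\<bar>"] by simp
  then show ?thesis
    by (simp add: detQ field_simps)
qed

text \<open>The identity in \<open>F\<close> gives a supremum at least \<open>N\<close>, hence
  definiteness; the common constant \<open>C\<close> keeps the suprema finite.\<close>

lemma sup_vector_norm:
  assumes N: "is_vector_norm N" and F: "mat 1 \<in> F" "\<And>P x. P \<in> F \<Longrightarrow> N (P *v x) \<le> C * N x"
  shows "is_vector_norm (\<lambda>x. SUP P\<in>F. N (P *v x))"
proof -
  define v where "v = (\<lambda>x. SUP P\<in>F. N (P *v x))"
  have ub: "N (P *v x) \<le> v x" if "P \<in> F" for P x
    unfolding v_def using F(2) by (intro cSUP_upper that bdd_aboveI2)
  have lub: "v x \<le> c" if "\<And>P. P \<in> F \<Longrightarrow> N (P *v x) \<le> c" for x c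
    unfolding v_def using F(1) that by (intro cSUP_least) auto
  have N_le: "N x \<le> v x" for x
    using ub[OF F(1), of x] by simp
  have scale_le: "v (c *\<^sub>R x) \<le> \<bar>c\<bar> * v x" for c x
    by (rule lub) (simp add: matrix_vector_mult_scaleR vector_normD(3)[OF N] mult_left_mono ub)
  have nonneg: "0 \<le> v x" for x
    using N_le[of x] vector_normD(1)[OF N, of x] by linarith
  have zero: "v x = 0 \<longleftrightarrow> x = 0" for x
  proof
    assume "v x = 0"
    then show "x = 0"
      using N_le[of x] vector_normD(1,2)[OF N, of x] by linarith
  next
    assume "x = 0"
    then show "v x = 0"
      using lub[of 0 0] nonneg[of 0] N by simp
  qed
  have "v (c *\<^sub>R x) = \<bar>c\<bar> * v x" for c x
  proof (cases "c = 0")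
    case False
    \<comment> \<open>The reverse inequality comes from scaling back by
      \<open>inverse c\<close>.\<close>
    have "\<bar>c\<bar> * v x \<le> v (c *\<^sub>R x)"
      using scale_le[of "inverse c" "c *\<^sub>R x"] False by (simp add: field_simps)
    then show ?thesis
      using scale_le[of c x] by simp
  qed (use zero in simp)
  moreover have "v (x + y) \<le> v x + v y" for x y
  proof (rule lub)
    fix P assume "P \<in> F"
    then show "N (P *v (x + y)) \<le> v x + v y"
      using vector_normD(4)[OF N, of "P *v x" "P *v y"] ub[of P x] ub[of P y]
      by (simp add: matrix_vector_right_distrib)
  qed
  ultimately show ?thesis
    unfolding v_def[symmetric] is_vector_norm_def using nonneg zero by blast
qed

section \<open>Induced matrix norms\<close>

lemma induced_norm_le:
  fixes N :: "real ^ 'd \<Rightarrow> real"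
  assumes N: "is_vector_norm N" and "\<And>x. N (M *v x) \<le> c * N x"
  shows "induced_norm N M \<le> c"
  unfolding induced_norm_def
proof (rule cSUP_least)
  obtain x :: "real ^ 'd" where "x \<noteq> 0"
    using zero_neq_one by blast
  then have "N (inverse (N x) *\<^sub>R x) = 1"
    using vector_normD(1,2)[OF N, of x] by (simp add: vector_normD(3)[OF N])
  then show "{x. N x = 1} \<noteq> {}"
    by blast
qed (metis assms(2) mem_Collect_eq mult.right_neutral)

text \<open>Comparison with the Euclidean operator norm; this makes the supremum in
  \<open>induced_norm\<close> finite.\<close>

lemma vector_norm_mult_le_bound:
  fixes N :: "real ^ 'd \<Rightarrow> real"
  assumes N: "is_vector_norm N"
  obtains c where "\<And>x. N (M *v x) \<le> c * N x"
proof -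
  obtain a where a: "a > 0" "\<And>x. norm x \<le> a * N x"
    using norm_le_vector_norm[OF assms] by blast
  obtain b where b: "b > 0" "\<And>x. N x \<le> b * norm x"
    using vector_norm_le_norm[OF assms] by blast
  have "N (M *v x) \<le> (b * onorm ((*v) M) * a) * N x" for x
  proof -
    have "N (M *v x) \<le> b * norm (M *v x)"
      by (rule b)
    also have "\<dots> \<le> b * (onorm ((*v) M) * norm x)"
      using b(1) by (intro mult_left_mono onorm matrix_vector_mul_bounded_linear) auto
    also have "\<dots> \<le> b * (onorm ((*v) M) * (a * N x))"
      using b(1) by (intro mult_left_mono a onorm_pos_le matrix_vector_mul_bounded_linear) auto
    finally show ?thesis
      by (simp add: mult.assoc)
  qed
  then show thesis
    by (rule that)
qed

lemma induced_norm_mult_le: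
  assumes N: "is_vector_norm N"
  shows "N (M *v x) \<le> induced_norm N M * N x"
proof (cases "x = 0")
  case False
  then have pos: "0 < N x"
    using vector_normD(1,2)[OF N, of x] by linarith
  obtain c where c: "\<And>x. N (M *v x) \<le> c * N x"
    using vector_norm_mult_le_bound[OF N, of M] by blast
  have "N (M *v (inverse (N x) *\<^sub>R x)) \<le> induced_norm N M"
    unfolding induced_norm_def
  proof (rule cSUP_upper)
    show "inverse (N x) *\<^sub>R x \<in> {x. N x = 1}"
      using pos by (simp add: vector_normD(3)[OF N])
    show "bdd_above ((\<lambda>x. N (M *v x)) ` {x. N x = 1})"
      using c by (intro bdd_aboveI2[of _ _ c]) (metis mem_Collect_eq mult.right_neutral)
  qed
  then show ?thesis
    using pos by (simp add: matrix_vector_mult_scaleR vector_normD(3)[OF N] field_simps)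
qed (use N in simp)

lemma induced_norm_nonneg:
  fixes N :: "real ^ 'd \<Rightarrow> real"
  assumes N: "is_vector_norm N"
  shows "0 \<le> induced_norm N M"
proof -
  have "N (M *v 1) \<le> induced_norm N M * N 1"
    by (rule induced_norm_mult_le[OF N])
  then have "0 \<le> induced_norm N M * N 1"
    using vector_normD(1)[OF N, of "M *v 1"] by linarith
  moreover have "0 < N 1"
    using vector_normD(1,2)[OF N, of 1] by simp
  ultimately show ?thesis
    by (simp add: zero_le_mult_iff)
qed

lemma uniform_matrix_bound:
  fixes A :: "'k::finite \<Rightarrow> real ^ 'd ^ 'd"
  assumes N: "is_vector_norm N"
  obtains H where "H \<ge> 1" "\<And>k x. N (A k *v x) \<le> H * N x"
proof
  \<comment> \<open>The sum over the finite alphabet dominates each norm; the extra 1 makes powers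
    of \<open>H\<close> nondecreasing in the exponent.\<close>
  let ?H = "1 + (\<Sum>k\<in>UNIV. induced_norm N (A k))"
  show "?H \<ge> 1"
    by (simp add: sum_nonneg induced_norm_nonneg[OF N])
  fix k x
  have "induced_norm N (A k) \<le> ?H"
    using member_le_sum[of k UNIV "\<lambda>k. induced_norm N (A k)"] induced_norm_nonneg[OF N]
    by simp
  then show "N (A k *v x) \<le> ?H * N x"
    by (rule order_trans[OF induced_norm_mult_le[OF N] mult_right_mono]) (rule vector_normD(1)[OF N])
qed

section \<open>Products along words\<close>

lemma word_prod_append: "word_prod A (u @ w) = word_prod A w ** word_prod A u"
  by (induction u) (simp_all add: matrix_mul_assoc)

lemma scaleR_matrix_mult: "(a *\<^sub>R X) ** (b *\<^sub>R Y) = (a * b) *\<^sub>R (X ** Y)"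
  for X :: "real ^ 'n ^ 'm" and Y :: "real ^ 'p ^ 'n"
  by (simp add: vec_eq_iff matrix_matrix_mult_def sum_distrib_left mult_ac)

lemma word_prod_scaleR: "word_prod (\<lambda>k. c *\<^sub>R A k) w = c ^ length w *\<^sub>R word_prod A w"
  by (induction w) (simp_all add: scaleR_matrix_mult mult.commute)

lemma word_prod_norm_le:
  fixes N :: "real ^ 'd \<Rightarrow> real"
  assumes H: "0 \<le> H" "\<And>k x. N (A k *v x) \<le> H * N x"
  shows "N (word_prod A w *v x) \<le> H ^ length w * N x"
proof (induction w arbitrary: x)
  case (Cons k w)
  have "N (word_prod A (k # w) *v x) \<le> H ^ length w * N (A k *v x)"
    using Cons.IH by (simp add: matrix_vector_mul_assoc[symmetric])
  also have "\<dots> \<le> H ^ length w * (H * N x)"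
    using H(1) by (intro mult_left_mono H(2)) auto
  finally show ?case
    by (simp add: mult_ac)
qed simp

text \<open>The one-step bound is applied once per letter of \<open>u\<close>. The final letter
  \<open>j\<close> only names the state reached; its matrix is not applied.\<close>

lemma word_prod_contraction:
  fixes v :: "'k \<Rightarrow> real ^ 'd \<Rightarrow> real"
  assumes "\<And>i j x. E i j \<Longrightarrow> v j (A i *v x) \<le> v i x" and "successively E (u @ [j])"
  shows "v j (word_prod A u *v x) \<le> v (hd (u @ [j])) x"
  using assms(2)
proof (induction u arbitrary: x)
  case (Cons i u)
  then have "E i (hd (u @ [j]))" "successively E (u @ [j])"
    by (simp_all add: successively_Cons)
  then show ?case
    using Cons.IH[of "A i *v x"] assms(1)[of i "hd (u @ [j])" x]
    by (simp add: matrix_vector_mul_assoc[symmetric])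
qed simp

section \<open>Halving over words of fixed length and exponential decay\<close>

lemma segment_decomposition:
  assumes "k \<le> m" "m < length w"
  shows "w = take k w @ (drop k (take m w) @ [w ! m]) @ drop (Suc m) w"
    and "hd (drop k (take m w) @ [w ! m]) = w ! k"
    and "take m w = take k w @ drop k (take m w)"
proof -
  show *: "take m w = take k w @ drop k (take m w)"
    using assms append_take_drop_id[of k "take m w"] by (simp add: min_def)
  show "w = take k w @ (drop k (take m w) @ [w ! m]) @ drop (Suc m) w"
    using assms append_take_drop_id[of "Suc m" w] *
    by (metis append.assoc take_Suc_conv_app_nth)
  have "drop k (take m w) @ [w ! m] = drop k (take (Suc m) w)"
    using assms by (simp add: take_Suc_conv_app_nth)
  then show "hd (drop k (take m w) @ [w ! m]) = w ! k"
    using assms by (simp add: hd_drop_conv_nth)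
qed

text \<open>Pigeonhole on normalised orbit points, sorted by state and by rounded Auerbach
  coordinates. The length is fixed before matrices, transitions and norms, so that all rescaled
  systems share it.\<close>

lemma uniform_halving_length:
  fixes l :: real
  assumes l: "0 \<le> l" "l < 1"
  obtains p where "p \<ge> 1"
    "\<And>(A :: 'k::finite \<Rightarrow> real ^ 'd ^ 'd) E v w x.
       (\<And>k. is_vector_norm (v k)) \<Longrightarrow>
       (\<And>i j x. E i j \<Longrightarrow> v j (A i *v x) \<le> v i x) \<Longrightarrow>
       (\<And>u z. u \<noteq> [] \<Longrightarrow> successively E u \<Longrightarrow> E (last u) (hd u) \<Longrightarrow>
          z \<in> complex_spectrum (word_prod A u) \<Longrightarrow> cmod z \<le> l) \<Longrightarrow>
       length w = Suc p \<Longrightarrow> successively E w \<Longrightarrow>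
       v (w ! p) (word_prod A (take p w) *v x) \<le> v (w ! 0) x / 2"
proof -
  define c :: real where "c = 2 * CARD('d) * fact CARD('d) * 2 ^ CARD('d)"
  \<comment> \<open>The mesh 1 / D is fine enough for the upper bound c / D on the determinant to
    fall below (1 - l) ^ d.\<close>
  obtain D :: nat where D: "c / (1 - l) ^ CARD('d) < D"
    using reals_Archimedean2 by blast
  have pow_pos: "0 < (1 - l) ^ CARD('d)"
    using l by simp
  have "0 < c"
    by (simp add: c_def)
  then have Dpos: "0 < real D"
    using D pow_pos by (meson divide_pos_pos less_trans)
  \<comment> \<open>The possible cells: a state and the integer parts of \<open>D\<close> times
    coordinates in [-1, 1]. The times 0 to \<open>card F\<close> outnumber them by one.\<close>
  define F where "F = (UNIV :: 'k set) \<times> ((UNIV :: 'd set) \<rightarrow>\<^sub>E {- int D..int D})"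
  have finF: "finite F"
    unfolding F_def by (intro finite_cartesian_product finite_PiE) auto
  have "(undefined, \<lambda>_. 0) \<in> F"
    by (auto simp: F_def)
  then have "card F \<ge> 1"
    using finF by (metis One_nat_def Suc_leI card_gt_0_iff empty_iff)
  moreover have "v (w ! card F) (word_prod A (take (card F) w) *v x) \<le> v (w ! 0) x / 2"
    if v: "\<And>k. is_vector_norm (v k)"
      and contr: "\<And>i j x. E i j \<Longrightarrow> v j (A i *v x) \<le> v i x"
      and spec: "\<And>u z. u \<noteq> [] \<Longrightarrow> successively E u \<Longrightarrow> E (last u) (hd u) \<Longrightarrow>
          z \<in> complex_spectrum (word_prod A u) \<Longrightarrow> cmod z \<le> l"
      and w: "length w = Suc (card F)" "successively E w"
    for A :: "'k \<Rightarrow> real ^ 'd ^ 'd" and E v w x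
  proof (rule ccontr)
    define p where "p = card F"
    assume "\<not> ?thesis"
    then have big: "v (w ! 0) x / 2 < v (w ! p) (word_prod A (take p w) *v x)"
      by (simp add: p_def)
    then have "x \<noteq> 0"
      using v by auto
    then have vx: "0 < v (w ! 0) x"
      using vector_normD(1,2)[OF v, of "w ! 0" x] by linarith
    define X where "X = (\<lambda>k. word_prod A (take k w) *v (inverse (v (w ! 0) x) *\<^sub>R x))"
    have lw: "m < length w" if "m \<le> p" for m
      using that w(1) by (simp add: p_def)
    have segment: "successively E (drop k (take m w) @ [w ! m])"
      "hd (drop k (take m w) @ [w ! m]) = w ! k"
      "X m = word_prod A (drop k (take m w)) *v X k" if "k \<le> m" "m \<le> p" for k m
    proof -
      note dec = segment_decomposition[OF that(1) lw[OF that(2)]]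
      show "successively E (drop k (take m w) @ [w ! m])"
        using w(2) by (subst (asm) dec(1)) (simp only: successively_append_iff)
      show "hd (drop k (take m w) @ [w ! m]) = w ! k"
        by (rule dec(2))
      have "word_prod A (take m w) = word_prod A (drop k (take m w)) ** word_prod A (take k w)"
        by (subst dec(3)) (rule word_prod_append)
      then show "X m = word_prod A (drop k (take m w)) *v X k"
        by (simp add: X_def matrix_vector_mul_assoc)
    qed
    have mono: "v (w ! m) (X m) \<le> v (w ! k) (X k)" if "k \<le> m" "m \<le> p" for k m
      using word_prod_contraction[where v = v, OF contr segment(1)[OF that], of "X k"]
      by (simp only: segment(2)[OF that] segment(3)[OF that, symmetric])
    have "v (w ! 0) (X 0) = 1"
      using vx by (simp add: X_def vector_normD(3)[OF v])
    then have upper: "v (w ! k) (X k) \<le> 1" if "k \<le> p" for k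
      using mono[of 0 k] that by simp
    \<comment> \<open>If halving fails at the end, monotonicity keeps all orbit points at norm at
      least 1 / 2.\<close>
    have "1 / 2 \<le> v (w ! p) (X p)"
      using big vx by (simp add: X_def matrix_vector_mult_scaleR vector_normD(3)[OF v] field_simps)
    then have lower: "1 / 2 \<le> v (w ! k) (X k)" if "k \<le> p" for k
      using mono[OF that] by simp
    have "\<forall>k. \<exists>M M'. auerbach_basis (v k) M M'"
      using auerbach_basis_exists[OF v] by blast
    then obtain M M' where basis: "\<And>k. auerbach_basis (v k) (M k) (M' k)"
      by metis
    \<comment> \<open>Coordinates are taken in the basis of the current state, so points in one cell
      share both basis and norm.\<close>
    define cell where "cell = (\<lambda>k. (w ! k, \<lambda>i. \<lfloor>D * (M' (w ! k) *v X k) $ i\<rfloor>))"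
    have "cell ` {..p} \<subseteq> F"
    proof
      fix y assume "y \<in> cell ` {..p}"
      then obtain k where k: "k \<le> p" "y = cell k" by auto
      have "\<lfloor>D * (M' (w ! k) *v X k) $ i\<rfloor> \<in> {- int D..int D}" for i
      proof -
        have "\<bar>(M' (w ! k) *v X k) $ i\<bar> \<le> 1"
          using basis[of "w ! k"] upper[OF k(1)] by (meson auerbach_basis_def order_trans)
        then have "real D * \<bar>(M' (w ! k) *v X k) $ i\<bar> \<le> real D * 1"
          by (intro mult_left_mono) auto
        then have "\<bar>real D * (M' (w ! k) *v X k) $ i\<bar> \<le> D"
          by (simp add: abs_mult)
        then show ?thesis
          by (simp add: abs_le_iff le_floor_iff floor_le_iff)
      qed
      then show "y \<in> F"
        by (simp add: F_def k cell_def PiE_UNIV_domain)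
    qed
    then have "card (cell ` {..p}) < card {..p}"
      using card_mono[OF finF] by (simp add: p_def le_imp_less_Suc)
    then have "\<not> inj_on cell {..p}"
      by (rule pigeonhole)
    then obtain a b where ab: "a < b" "b \<le> p" "cell a = cell b"
      unfolding inj_on_def by (metis atMost_iff linorder_neqE_nat)
    then have le: "a \<le> b" "a \<le> p" by simp_all
    \<comment> \<open>The letters applied between times \<open>a\<close> and \<open>b\<close>. The
      state at \<open>b\<close> is that at \<open>a\<close>, so \<open>u\<close> closes up to a
      periodic word.\<close>
    define u where "u = drop a (take b w)"
    have state: "w ! a = w ! b"
      using ab(3) by (simp add: cell_def)
    have "u \<noteq> []"
      using ab lw[of b] by (simp add: u_def)
    then have u: "successively E u" "E (last u) (hd u)" "hd u = w ! b"
      using segment(1,2)[OF le(1) ab(2)] by (auto simp: u_def[symmetric] successively_append_iff state)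
    let ?P = "word_prod A u"
    have "v (w ! b) (?P *v y) \<le> v (w ! b) y" for y
      using word_prod_contraction[where v = v, OF contr segment(1)[OF le(1) ab(2)], of y]
      by (simp only: segment(2)[OF le(1) ab(2)] u_def state)
    moreover have "\<bar>(M' (w ! b) *v (X a - ?P *v X a)) $ i\<bar> \<le> 1 / D" for i
    proof -
      let ?f = "\<lambda>k. (M' (w ! b) *v X k) $ i"
      \<comment> \<open>Equal integer parts: the coordinates of \<open>X a\<close> and of its image
        \<open>X b\<close> differ by at most 1 / D.\<close>
      have "\<lfloor>D * ?f a\<rfloor> = \<lfloor>D * ?f b\<rfloor>"
        using ab(3) by (auto simp: cell_def state fun_eq_iff)
      then have "\<bar>D * ?f a - D * ?f b\<bar> \<le> 1"
        by linarith
      then have "D * \<bar>?f a - ?f b\<bar> \<le> 1"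
        by (simp add: abs_mult right_diff_distrib[symmetric])
      then show ?thesis
        using Dpos segment(3)[OF le(1) ab(2)]
        by (simp add: matrix_vector_mult_diff_distrib u_def field_simps)
    qed
    ultimately have "\<bar>det (mat 1 - ?P)\<bar> \<le> c * (1 / D)"
      unfolding c_def
      using abs_det_mat_1_minus_le[OF v _ basis, of "w ! b" ?P "X a" "1 / D"] lower[OF le(2)]
      by (simp add: state)
    moreover have "(1 - l) ^ CARD('d) \<le> \<bar>det (mat 1 - ?P)\<bar>"
      using spec[OF \<open>u \<noteq> []\<close> u(1,2)] l by (intro det_mat_1_minus_ge)
    ultimately have "(1 - l) ^ CARD('d) \<le> c * (1 / D)"
      by simp
    then show False
      using D Dpos pow_pos by (simp add: field_simps)
  qed
  ultimately show thesis
    by (rule that)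
qed

text \<open>Halving every \<open>p\<close> letters outweighs a growth factor of
  \<open>root p 2\<close> per letter; the incomplete last block costs the factor 2 in the
  constant.\<close>

lemma bounded_products_boost:
  fixes A :: "'k::finite \<Rightarrow> real ^ 'd ^ 'd"
  assumes N: "is_vector_norm N" and r: "0 < r"
    and bound: "\<And>w x. successively E w \<Longrightarrow> r ^ length w * N (word_prod A w *v x) \<le> C * N x"
    and p: "p \<ge> 1"
    and halving: "\<And>v w x. (\<And>k. is_vector_norm (v k)) \<Longrightarrow>
       (\<And>i j x. E i j \<Longrightarrow> v j ((r *\<^sub>R A i) *v x) \<le> v i x) \<Longrightarrow>
       length w = Suc p \<Longrightarrow> successively E w \<Longrightarrow>
       v (w ! p) (word_prod (\<lambda>k. r *\<^sub>R A k) (take p w) *v x) \<le> v (w ! 0) x / 2"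
    and w: "successively E w"
  shows "(root p 2 * r) ^ length w * N (word_prod A w *v x) \<le> 2 * C * N x"
proof -
  let ?A = "\<lambda>k. r *\<^sub>R A k"
  have scaled: "N (word_prod ?A w *v x) = r ^ length w * N (word_prod A w *v x)" for w x
    using r by (simp add: word_prod_scaleR scaleR_matrix_vector_assoc[symmetric] vector_normD(3)[OF N])
  define W where "W = (\<lambda>i. {w. successively E w \<and> (w = [] \<or> hd w = i)})"
  define v where "v = (\<lambda>i x. SUP P\<in>word_prod ?A ` W i. N (P *v x))"
  have family: "mat 1 \<in> word_prod ?A ` W i" for i
    by (rule image_eqI[of _ _ "[]"]) (auto simp: W_def)
  have family_le: "N (P *v x) \<le> C * N x" if P: "P \<in> word_prod ?A ` W i" for P x i
  proof -
    obtain w where "w \<in> W i" "P = word_prod ?A w"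
      using P by blast
    moreover from this have "successively E w"
      by (auto simp: W_def)
    ultimately show ?thesis
      using bound[of w x] by (simp only: scaled)
  qed
  have v_norm: "is_vector_norm (v i)" for i
    unfolding v_def by (rule sup_vector_norm[OF N family family_le])
  have v_ub: "N (word_prod ?A w *v x) \<le> v i x" if "w \<in> W i" for w x i
    unfolding v_def
  proof (rule cSUP_upper2[where x = "word_prod ?A w"])
    show "bdd_above ((\<lambda>P. N (P *v x)) ` word_prod ?A ` W i)"
      by (rule bdd_aboveI2) (rule family_le)
  qed (use that in simp_all)
  have v_lub: "v i x \<le> c" if "\<And>w. w \<in> W i \<Longrightarrow> N (word_prod ?A w *v x) \<le> c" for i x c
    unfolding v_def
  proof (rule cSUP_least)
    show "word_prod ?A ` W i \<noteq> {}"
      using family[of i] by blast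
  qed (use that in blast)
  have v_le: "v i x \<le> C * N x" for i x
    by (rule v_lub) (use family_le in blast)
  have contr: "v j ((r *\<^sub>R A i) *v x) \<le> v i x" if "E i j" for i j x
  proof (rule v_lub)
    fix w assume "w \<in> W j"
    then have "i # w \<in> W i"
      using that by (auto simp: W_def successively_Cons)
    from v_ub[OF this, of x] show "N (word_prod ?A w *v ((r *\<^sub>R A i) *v x)) \<le> v i x"
      by (simp add: matrix_vector_mul_assoc[symmetric])
  qed
  \<comment> \<open>The inequality is strict because each halving needs one letter after its block
    to name the state reached.\<close>
  have decay: "N (word_prod ?A w *v x) \<le> v (hd w) x / 2 ^ q"
    if "successively E w" "q * p < length w" for q w x
    using that
  proof (induction q arbitrary: w x)
    case 0
    then show ?case
      using v_ub[of w "hd w" x] by (simp add: W_def)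
  next
    case (Suc q)
    have len: "p < length w" "q * p < length (drop p w)"
      using Suc.prems(2) by auto
    have suc: "successively E (drop p w)" "successively E (take (Suc p) w)"
      using Suc.prems(1) successively_append_iff[of E "take p w" "drop p w"]
        successively_append_iff[of E "take (Suc p) w" "drop (Suc p) w"]
      by simp_all
    have "N (word_prod ?A w *v x) = N (word_prod ?A (drop p w) *v (word_prod ?A (take p w) *v x))"
      by (simp add: matrix_vector_mul_assoc word_prod_append[symmetric])
    also have "\<dots> \<le> v (hd (drop p w)) (word_prod ?A (take p w) *v x) / 2 ^ q"
      by (rule Suc.IH[OF suc(1) len(2)])
    also have "\<dots> \<le> (v (w ! 0) x / 2) / 2 ^ q"
      using halving[of v "take (Suc p) w" x, OF v_norm contr _ suc(2)] len(1)
      by (intro divide_right_mono) (simp_all add: hd_drop_conv_nth min_def)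
    finally show ?case
      using len(1) by (subst hd_conv_nth) auto
  qed
  show ?thesis
  proof (cases "w = []")
    case True
    then show ?thesis
      using bound[of "[]" x] vector_normD(1)[OF N, of x] by simp
  next
    case False
    \<comment> \<open>The largest number of blocks that leaves at least one letter over.\<close>
    define q where "q = (length w - 1) div p"
    have div: "q * p + (length w - 1) mod p = length w - 1"
      by (simp add: q_def)
    moreover have "(length w - 1) mod p < p"
      using p by simp
    ultimately have len: "q * p < length w" "length w \<le> Suc q * p"
      using False by (cases w; simp)+
    have "root p 2 ^ length w \<le> root p 2 ^ (Suc q * p)"
      using p len(2) by (intro power_increasing) (auto simp: real_root_ge_1_iff)
    also have "\<dots> = 2 ^ Suc q"
      using p by (simp only: mult.commute[of _ p] power_mult) simp
    finally have root_le: "root p 2 ^ length w \<le> 2 ^ Suc q" .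
    have "(root p 2 * r) ^ length w * N (word_prod A w *v x)
        = root p 2 ^ length w * N (word_prod ?A w *v x)"
      by (simp add: scaled power_mult_distrib)
    also have "\<dots> \<le> 2 ^ Suc q * (v (hd w) x / 2 ^ q)"
      by (intro mult_mono root_le decay w len vector_normD(1)[OF N]) simp
    also have "\<dots> \<le> 2 * (C * N x)"
      using v_le by simp
    finally show ?thesis
      by simp
  qed
qed

text \<open>Starting from \<open>inverse H\<close>, where boundedness is trivial, the admissible
  scale is raised by the fixed factor \<open>root p 2\<close> until it exceeds 1.\<close>

lemma exponential_decay_of_periodic_spectrum:
  fixes A :: "'k::finite \<Rightarrow> real ^ 'd ^ 'd"
  assumes N: "is_vector_norm N" and l: "0 \<le> l" "l < 1"
    and spec: "\<And>u z. u \<noteq> [] \<Longrightarrow> successively E u \<Longrightarrow> E (last u) (hd u) \<Longrightarrow>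
          z \<in> complex_spectrum (word_prod A u) \<Longrightarrow> cmod z \<le> l"
  obtains r C where "r > 1" "C > 0"
    "\<And>w x. successively E w \<Longrightarrow> r ^ length w * N (word_prod A w *v x) \<le> C * N x"
proof -
  define G where "G = (\<lambda>r. \<exists>C>0. \<forall>w x. successively E w \<longrightarrow>
      r ^ length w * N (word_prod A w *v x) \<le> C * N x)"
  obtain p where p: "p \<ge> 1"
    and halving: "\<And>(B :: 'k \<Rightarrow> real ^ 'd ^ 'd) E v w x.
       (\<And>k. is_vector_norm (v k)) \<Longrightarrow>
       (\<And>i j x. E i j \<Longrightarrow> v j (B i *v x) \<le> v i x) \<Longrightarrow>
       (\<And>u z. u \<noteq> [] \<Longrightarrow> successively E u \<Longrightarrow> E (last u) (hd u) \<Longrightarrow>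
          z \<in> complex_spectrum (word_prod B u) \<Longrightarrow> cmod z \<le> l) \<Longrightarrow>
       length w = Suc p \<Longrightarrow> successively E w \<Longrightarrow>
       v (w ! p) (word_prod B (take p w) *v x) \<le> v (w ! 0) x / 2"
    using uniform_halving_length[OF l, where 'k = 'k and 'd = 'd] by metis
  have root: "1 < root p 2"
    using p by (simp add: real_root_gt_1_iff)
  \<comment> \<open>For \<open>r \<le> 1\<close> scaling only shrinks the eigenvalues, so the bound
    \<open>l\<close>, and with it \<open>p\<close>, remains valid.\<close>
  have boost: "G (root p 2 * r)" if r: "0 < r" "r \<le> 1" and "G r" for r
  proof -
    obtain C where C: "C > 0"
      and bound: "\<And>w x. successively E w \<Longrightarrow> r ^ length w * N (word_prod A w *v x) \<le> C * N x"
      using \<open>G r\<close> unfolding G_def by blast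
    have "cmod z \<le> l"
      if u: "u \<noteq> []" "successively E u" "E (last u) (hd u)"
        and z: "z \<in> complex_spectrum (word_prod (\<lambda>k. r *\<^sub>R A k) u)" for u z
    proof -
      let ?c = "r ^ length u"
      have c: "0 < ?c" "?c \<le> 1"
        using r by (auto intro: power_le_one)
      have "of_real (inverse ?c) * z \<in> complex_spectrum (inverse ?c *\<^sub>R (?c *\<^sub>R word_prod A u))"
        using z by (intro complex_spectrum_scaleR) (simp add: word_prod_scaleR)
      then have "of_real (inverse ?c) * z \<in> complex_spectrum (word_prod A u)"
        using r by simp
      then have "cmod (of_real (inverse ?c) * z) \<le> l"
        by (rule spec[OF u])
      then have "cmod z \<le> ?c * l"
        using c r by (simp add: norm_mult norm_divide norm_inverse norm_power field_simps)
      also have "\<dots> \<le> l"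
        using c l by (simp add: mult_left_le_one_le)
      finally show ?thesis .
    qed
    then have "successively E w \<Longrightarrow>
        (root p 2 * r) ^ length w * N (word_prod A w *v x) \<le> 2 * C * N x" for w x
      by (intro bounded_products_boost[OF N r(1) bound p] halving) auto
    then show ?thesis
      unfolding G_def using C by (intro exI[of _ "2 * C"]) auto
  qed
  obtain H where H: "H \<ge> 1" "\<And>k x. N (A k *v x) \<le> H * N x"
    using uniform_matrix_bound[OF N] by blast
  have "G (inverse H)"
  proof -
    have "inverse H ^ length w * N (word_prod A w *v x) \<le> 1 * N x" for w x
      using word_prod_norm_le[of H N A w x] H by (simp add: field_simps power_inverse)
    then show ?thesis
      unfolding G_def by (intro exI[of _ 1]) auto
  qed
  \<comment> \<open>The first alternative absorbs the case that the current scale exceeds 1, where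
    \<open>boost\<close> does not apply.\<close>
  then have step: "(\<exists>r>1. G r) \<or> G (root p 2 ^ k * inverse H)" for k
  proof (induction k)
    case (Suc k)
    have "0 < root p 2 ^ k * inverse H"
      using H(1) root by simp
    then show ?case
      using Suc boost[of "root p 2 ^ k * inverse H"] by (force simp: mult.assoc not_le)
  qed simp
  obtain k where "H < root p 2 ^ k"
    using real_arch_pow[OF root] by blast
  then have "1 < root p 2 ^ k * inverse H"
    using H(1) by (simp add: field_simps)
  then have "\<exists>r>1. G r"
    using step[of k] by blast
  then show thesis
    unfolding G_def using that by blast
qed

section \<open>Perturbations of exponentially stable systems\<close>

text \<open>\<open>N\<close> measures real vectors only, so a complex eigenvector is followed
  through its real and imaginary parts. An eigenvalue outside the open disc would keep an entry from
  decaying.\<close>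

lemma cmod_eigenvalue_less_1:
  fixes M :: "real ^ 'd ^ 'd"
  assumes N: "is_vector_norm N" and contr: "\<And>x. N (M *v x) \<le> t * N x" and t: "0 \<le> t" "t < 1"
    and z: "z \<in> complex_spectrum M"
  shows "cmod z < 1"
proof (rule ccontr)
  assume "\<not> cmod z < 1"
  then have z1: "1 \<le> cmod z" by simp
  obtain a where a: "a > 0" "\<And>x. norm x \<le> a * N x"
    using norm_le_vector_norm[OF N] by blast
  obtain v where "v \<noteq> 0" and v: "map_matrix complex_of_real M *v v = z *s v"
    using z by (auto simp: complex_spectrum_def)
  then obtain i where i: "v $ i \<noteq> 0"
    by (auto simp: vec_eq_iff)
  \<comment> \<open>Since \<open>M\<close> is real, the two parts of z ^ j v are separate orbits of
    \<open>M\<close>.\<close>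
  define re im where "re j = (\<chi> k. Re (z ^ j * v $ k))" and "im j = (\<chi> k. Im (z ^ j * v $ k))" for j
  have step: "z ^ Suc j * v $ k = (\<Sum>m\<in>UNIV. of_real (M $ k $ m) * (z ^ j * v $ m))" for j k
  proof -
    have "z * v $ k = (\<Sum>m\<in>UNIV. of_real (M $ k $ m) * v $ m)"
      using arg_cong[OF v, of "\<lambda>x. x $ k"] by (simp add: matrix_vector_mult_def)
    then have "z ^ j * (z * v $ k) = (\<Sum>m\<in>UNIV. z ^ j * (of_real (M $ k $ m) * v $ m))"
      by (simp only: sum_distrib_left)
    then show ?thesis
      by (simp add: mult_ac)
  qed
  have "re (Suc j) = M *v re j" "im (Suc j) = M *v im j" for j
    unfolding re_def im_def step by (simp_all add: vec_eq_iff matrix_vector_mult_def)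
  moreover have iter: "N (f j) \<le> t ^ j * N (f 0)" if "\<And>j. f (Suc j) = M *v f j" for f j
  proof (induction j)
    case (Suc j)
    have "N (f (Suc j)) \<le> t * N (f j)"
      by (simp only: that contr)
    also have "\<dots> \<le> t * (t ^ j * N (f 0))"
      by (intro mult_left_mono Suc t)
    finally show ?case
      by (simp add: mult.assoc)
  qed simp
  ultimately have bounds: "N (re j) \<le> t ^ j * N (re 0)" "N (im j) \<le> t ^ j * N (im 0)" for j
    by blast+
  have "cmod (v $ i) \<le> t ^ j * (a * (N (re 0) + N (im 0)))" for j
  proof -
    have "cmod (v $ i) \<le> cmod (z ^ j * v $ i)"
      using z1 mult_right_mono[of 1 "cmod z ^ j" "cmod (v $ i)"]
      by (simp add: norm_mult norm_power)
    also have "\<dots> \<le> \<bar>re j $ i\<bar> + \<bar>im j $ i\<bar>"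
      unfolding re_def im_def vec_lambda_beta by (rule cmod_le)
    also have "\<dots> \<le> norm (re j) + norm (im j)"
      by (intro add_mono component_le_norm_cart)
    also have "\<dots> \<le> a * N (re j) + a * N (im j)"
      by (intro add_mono a)
    also have "\<dots> \<le> a * (t ^ j * N (re 0)) + a * (t ^ j * N (im 0))"
      using a(1) by (intro add_mono mult_left_mono bounds) auto
    finally show ?thesis
      by (simp add: algebra_simps)
  qed
  moreover have "(\<lambda>j. t ^ j * (a * (N (re 0) + N (im 0)))) \<longlonglongrightarrow> 0 * (a * (N (re 0) + N (im 0)))"
    using t by (intro tendsto_mult LIMSEQ_realpow_zero tendsto_const) auto
  ultimately have "cmod (v $ i) \<le> 0 * (a * (N (re 0) + N (im 0)))"
    by (intro LIMSEQ_le_const) auto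
  then show False
    using i by simp
qed

text \<open>Telescoping: letters are exchanged one at a time, and each exchange costs at most
  \<open>e\<close> times the bound \<open>H ^ length w\<close> for the remaining factors.\<close>

lemma word_prod_perturbation:
  fixes N :: "real ^ 'd \<Rightarrow> real" and A B :: "'k \<Rightarrow> real ^ 'd ^ 'd" and H e :: real
  assumes N: "is_vector_norm N" and H: "1 \<le> H"
    "\<And>k x. N (A k *v x) \<le> H * N x" "\<And>k x. N (B k *v x) \<le> H * N x"
    and e: "0 \<le> e" "\<And>k x. N ((A k - B k) *v x) \<le> e * N x"
  shows "N (word_prod B w *v x - word_prod A w *v x) \<le> length w * H ^ length w * e * N x"
proof (induction w arbitrary: x)
  case (Cons k w)
  let ?n = "length w"
  have Nx: "0 \<le> N x"
    by (rule vector_normD(1)[OF N])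
  have "N (word_prod B (k # w) *v x - word_prod A (k # w) *v x)
      = N ((word_prod B w *v (B k *v x) - word_prod A w *v (B k *v x)) - word_prod A w *v ((A k - B k) *v x))"
    by (simp add: matrix_vector_mul_assoc[symmetric] matrix_vector_mult_diff_rdistrib
        matrix_vector_mult_diff_distrib)
  also have "\<dots> \<le> N (word_prod B w *v (B k *v x) - word_prod A w *v (B k *v x))
      + N (word_prod A w *v ((A k - B k) *v x))"
    by (rule vector_norm_diff[OF N])
  also have "\<dots> \<le> ?n * H ^ ?n * e * N (B k *v x) + H ^ ?n * N ((A k - B k) *v x)"
    using H by (intro add_mono Cons.IH word_prod_norm_le) auto
  also have "\<dots> \<le> ?n * H ^ ?n * e * (H * N x) + H ^ ?n * (e * N x)"
    using H(1) e(1) by (intro add_mono mult_left_mono H e) auto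
  also have "\<dots> \<le> ?n * H ^ ?n * e * (H * N x) + H ^ Suc ?n * (e * N x)"
    using H(1) e(1) Nx by (intro add_left_mono mult_right_mono power_increasing) auto
  finally show ?case
    by (simp add: algebra_simps)
qed (use N in simp)

section \<open>Powers of periodic words, cut into blocks\<close>

lemma complex_spectrum_word_power:
  assumes "z \<in> complex_spectrum (word_prod B u)"
  shows "z ^ j \<in> complex_spectrum (word_prod B (concat (replicate j u)))"
proof -
  obtain v where v: "v \<noteq> 0" "map_matrix complex_of_real (word_prod B u) *v v = z *s v"
    using assms by (auto simp: complex_spectrum_def)
  have mult: "map_matrix complex_of_real (X ** Y) = map_matrix complex_of_real X ** map_matrix complex_of_real Y"
    for X Y :: "real ^ 'a ^ 'a"
    by (simp add: vec_eq_iff matrix_matrix_mult_def)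
  have one: "map_matrix complex_of_real (mat 1 :: real ^ 'a ^ 'a) = mat 1"
    by (simp add: vec_eq_iff mat_def)
  have "map_matrix complex_of_real (word_prod B (concat (replicate j u))) *v v = z ^ j *s v"
  proof (induction j)
    case (Suc j)
    have "map_matrix complex_of_real (word_prod B (concat (replicate j u))) *v (z *s v)
        = z *s (map_matrix complex_of_real (word_prod B (concat (replicate j u))) *v v)"
      by (rule vector_scalar_commute)
    then show ?case
      using Suc v by (simp add: word_prod_append mult matrix_vector_mul_assoc[symmetric])
  qed (simp add: one)
  then show ?thesis
    using v(1) by (auto simp: complex_spectrum_def)
qed

text \<open>As a stretch of a periodic sequence, a power of \<open>u\<close> can be cut into blocks
  whose length is unrelated to that of \<open>u\<close>.\<close>

lemma concat_replicate_eq_map_mod: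
  "concat (replicate j u) = map (\<lambda>k. u ! (k mod length u)) [0..<j * length u]"
proof (induction j)
  case (Suc j)
  have "map (\<lambda>k. u ! (k mod length u)) [j * length u..<j * length u + length u] = u"
    by (rule nth_equalityI) auto
  then have "map (\<lambda>k. u ! (k mod length u)) [0..<Suc j * length u] = concat (replicate j u) @ u"
    using Suc upt_add_eq_append[of 0 "j * length u" "length u"] by (simp add: add.commute)
  also have "\<dots> = concat (replicate (Suc j) u)"
    by (metis concat_append concat.simps append_Nil2 replicate_Suc replicate_append_same)
  finally show ?case ..
qed simp

lemma block_contraction:
  fixes N :: "real ^ 'd \<Rightarrow> real"
  assumes t: "0 \<le> t" and block: "\<And>q x. N (word_prod B (map \<tau> [q..<q + m]) *v x) \<le> t * N x"
  shows "N (word_prod B (map \<tau> [0..<j * m]) *v x) \<le> t ^ j * N x"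
proof (induction j)
  case (Suc j)
  have "map \<tau> [0..<Suc j * m] = map \<tau> [0..<j * m] @ map \<tau> [j * m..<j * m + m]"
    using upt_add_eq_append[of 0 "j * m" m] by (simp add: add.commute)
  then have "N (word_prod B (map \<tau> [0..<Suc j * m]) *v x)
      \<le> t * N (word_prod B (map \<tau> [0..<j * m]) *v x)"
    using block[of "j * m"] by (simp add: word_prod_append matrix_vector_mul_assoc[symmetric])
  also have "\<dots> \<le> t * (t ^ j * N x)"
    by (intro mult_left_mono Suc t)
  finally show ?case
    by (simp add: mult.assoc)
qed simp

text \<open>The closing transition of \<open>u\<close> joins consecutive periods. The offset
  \<open>q\<close> lets a block start anywhere, and the \<open>- 1\<close> makes index 1 correspond
  to position \<open>q\<close>.\<close>

lemma shifted_periodic_admissible: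
  assumes "u \<in> periodic_words T n" "n \<ge> 1"
  shows "(\<lambda>k. u ! ((q + k - 1) mod n)) \<in> admissible_seqs T"
proof -
  have u: "length u = n" "\<And>k. 1 \<le> k \<Longrightarrow> k < n \<Longrightarrow> T $ (u ! (k - 1)) $ (u ! k) = 1"
    "T $ (u ! (n - 1)) $ (u ! 0) = 1"
    using assms by (auto simp: periodic_words_def)
  have next_letter: "T $ (u ! (j mod n)) $ (u ! (Suc j mod n)) = 1" for j
  proof (cases "Suc (j mod n) = n")
    case True
    then have "j mod n = n - 1" by linarith
    then show ?thesis
      using u(3) True by (simp add: mod_Suc)
  next
    case False
    moreover have "j mod n < n"
      using assms by simp
    ultimately show ?thesis
      using u(2)[of "Suc (j mod n)"] by (simp add: mod_Suc)
  qed
  have "T $ (u ! ((q + k - 1) mod n)) $ (u ! ((q + (k + 1) - 1) mod n)) = 1" if "k \<ge> 1" for k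
    using next_letter[of "q + k - 1"] that by (simp del: One_nat_def)
  then show ?thesis
    by (simp only: admissible_seqs_def mem_Collect_eq) blast
qed

text \<open>Blocks of a fixed length \<open>m\<close> contract by 1 / 4, and a small perturbation
  adds at most 1 / 4. The perturbed blocks still contract by 1 / 2, whatever the period of the
  word.\<close>

lemma robustly_periodically_stable_if_uniformly_exponentially_stable:
  fixes N :: "real ^ 'd \<Rightarrow> real" and A :: "'k::finite \<Rightarrow> real ^ 'd ^ 'd"
  assumes N: "is_vector_norm N" and "uniformly_exponentially_stable N A T"
  shows "robustly_periodically_stable N A T"
proof -
  obtain C \<gamma> where C: "C > 0" "0 < \<gamma>" "\<gamma> < 1"
    and decay: "\<And>n \<sigma>. n \<ge> 1 \<Longrightarrow> \<sigma> \<in> admissible_seqs T \<Longrightarrow>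
      induced_norm N (word_prod A (map \<sigma> [1..<n + 1])) \<le> C * \<gamma> ^ n"
    using assms(2) unfolding uniformly_exponentially_stable_def by blast
  obtain m0 where m0: "\<gamma> ^ m0 < inverse (4 * C)"
    using real_arch_pow_inv[of "inverse (4 * C)" \<gamma>] C by auto
  \<comment> \<open>The successor ensures \<open>m \<ge> 1\<close>, where the decay estimate is
    available.\<close>
  define m where "m = Suc m0"
  have "\<gamma> ^ m \<le> \<gamma> ^ m0"
    unfolding m_def using C by (intro power_decreasing) auto
  then have "C * \<gamma> ^ m \<le> C * inverse (4 * C)"
    by (intro mult_left_mono order_trans[OF _ less_imp_le[OF m0]] less_imp_le[OF C(1)])
  then have m: "C * \<gamma> ^ m \<le> 1 / 4"
    using C by simp
  obtain H0 where H0: "H0 \<ge> 1" "\<And>k x. N (A k *v x) \<le> H0 * N x"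
    using uniform_matrix_bound[OF N] by blast
  \<comment> \<open>One more than \<open>H0\<close>, so that \<open>H\<close> bounds the perturbed
    matrices as well, given \<open>\<epsilon> \<le> 1\<close>.\<close>
  define H where "H = H0 + 1"
  define \<epsilon> where "\<epsilon> = min 1 (1 / (4 * (m * H ^ m)))"
  have H1: "1 \<le> H"
    using H0 by (simp add: H_def)
  have \<epsilon>: "0 < \<epsilon>" "\<epsilon> \<le> 1" "m * H ^ m * \<epsilon> \<le> 1 / 4"
  proof -
    have pos: "0 < m * H ^ m"
      using H1 by (simp add: m_def)
    then show "0 < \<epsilon>" "\<epsilon> \<le> 1"
      by (auto simp: \<epsilon>_def mult.assoc)
    have "\<epsilon> \<le> 1 / (4 * (m * H ^ m))"
      by (simp add: \<epsilon>_def)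
    then show "m * H ^ m * \<epsilon> \<le> 1 / 4"
      using pos by (simp only: pos_le_divide_eq) (simp add: mult_ac)
  qed
  have "specrad (word_prod B u) < 1"
    if B: "\<And>k. induced_norm N (A k - B k) < \<epsilon>" and n: "n \<ge> 1" and u: "u \<in> periodic_words T n"
    for B n u
  proof -
    have diff: "N ((A k - B k) *v x) \<le> \<epsilon> * N x" for k x
      using induced_norm_mult_le[OF N, of "A k - B k" x] B[of k] vector_normD(1)[OF N, of x]
      by (meson less_imp_le mult_right_mono order_trans)
    have HA: "N (A k *v x) \<le> H * N x" for k x
      using H0(2)[of k x] vector_normD(1)[OF N, of x] by (simp add: H_def algebra_simps)
    have HB: "N (B k *v x) \<le> H * N x" for k x
    proof -
      have "N (B k *v x) = N (A k *v x - (A k - B k) *v x)"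
        by (simp add: matrix_vector_mult_diff_rdistrib)
      also have "\<dots> \<le> N (A k *v x) + N ((A k - B k) *v x)"
        by (rule vector_norm_diff[OF N])
      also have "\<dots> \<le> H0 * N x + 1 * N x"
        using diff[of k x] \<epsilon>(2) vector_normD(1)[OF N, of x]
        by (intro add_mono H0) (meson mult_right_mono order_trans)
      finally show ?thesis
        by (simp add: H_def algebra_simps)
    qed
    have len: "length u = n"
      using u by (simp add: periodic_words_def)
    define \<tau> where "\<tau> = (\<lambda>k. u ! (k mod n))"
    have block: "N (word_prod B (map \<tau> [q..<q + m]) *v x) \<le> 1 / 2 * N x" for q x
    proof -
      let ?\<sigma> = "\<lambda>k. u ! ((q + k - 1) mod n)" and ?w = "map \<tau> [q..<q + m]"
      have "?w = map ?\<sigma> [1..<m + 1]"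
        by (rule nth_equalityI) (auto simp: \<tau>_def simp del: upt_Suc)
      then have "induced_norm N (word_prod A ?w) \<le> 1 / 4"
        using decay[OF _ shifted_periodic_admissible[OF u n, of q], of m] m by (simp add: m_def)
      then have wA: "N (word_prod A ?w *v x) \<le> 1 / 4 * N x"
        by (rule order_trans[OF induced_norm_mult_le[OF N] mult_right_mono])
           (rule vector_normD(1)[OF N])
      have "N (word_prod B ?w *v x - word_prod A ?w *v x) \<le> m * H ^ m * \<epsilon> * N x"
        using word_prod_perturbation[where A = A and B = B and w = ?w and x = x, OF N H1 HA HB _ diff] \<epsilon>(1) by simp
      also have "\<dots> \<le> 1 / 4 * N x"
        by (rule mult_right_mono[OF \<epsilon>(3) vector_normD(1)[OF N]])
      finally have "N (word_prod B ?w *v x - word_prod A ?w *v x) \<le> 1 / 4 * N x" .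
      then show ?thesis
        using wA vector_normD(4)[OF N, of "word_prod B ?w *v x - word_prod A ?w *v x" "word_prod A ?w *v x"]
        by simp
    qed
    have "cmod z < 1" if z: "z \<in> complex_spectrum (word_prod B u)" for z
    proof -
      \<comment> \<open>The \<open>m\<close>-th power of \<open>u\<close> has \<open>n * m\<close>
        letters, hence exactly \<open>n\<close> blocks of length \<open>m\<close>.\<close>
      have word: "concat (replicate m u) = map \<tau> [0..<n * m]"
        by (simp add: concat_replicate_eq_map_mod len \<tau>_def mult.commute)
      have "cmod (z ^ m) < 1"
      proof (rule cmod_eigenvalue_less_1[OF N])
        show "z ^ m \<in> complex_spectrum (word_prod B (map \<tau> [0..<n * m]))"
          using complex_spectrum_word_power[OF z, of m] by (simp only: word)
        show "N (word_prod B (map \<tau> [0..<n * m]) *v x) \<le> (1 / 2) ^ n * N x" for x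
          by (rule block_contraction[OF _ block]) simp
        show "(1 / 2) ^ n < (1::real)"
          using n by (simp add: power_less_one_iff del: power_divide)
      qed simp
      then show ?thesis
        by (metis norm_ge_zero norm_power not_le_imp_less one_le_power not_less)
    qed
    then show ?thesis
      by (simp add: specrad_less_iff)
  qed
  then show ?thesis
    unfolding robustly_periodically_stable_def using \<epsilon>(1) by blast
qed

text \<open>Scaling all matrices by 1 + \<eta> is an allowed perturbation and multiplies the
  eigenvalues of a product of n letters by (1 + \<eta>) ^ n, which yields a uniform gap below
  1.\<close>

lemma uniformly_exponentially_stable_if_robustly_periodically_stable:
  fixes N :: "real ^ 'd \<Rightarrow> real" and A :: "'k::finite \<Rightarrow> real ^ 'd ^ 'd"
  assumes N: "is_vector_norm N" and "robustly_periodically_stable N A T"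
  shows "uniformly_exponentially_stable N A T"
proof -
  obtain \<epsilon> where \<epsilon>: "\<epsilon> > 0"
    and stable: "\<And>B n w. (\<And>k. induced_norm N (A k - B k) < \<epsilon>) \<Longrightarrow> n \<ge> 1 \<Longrightarrow>
      w \<in> periodic_words T n \<Longrightarrow> specrad (word_prod B w) < 1"
    using assms(2) unfolding robustly_periodically_stable_def by metis
  obtain H where H: "H \<ge> 1" "\<And>k x. N (A k *v x) \<le> H * N x"
    using uniform_matrix_bound[OF N] by blast
  define \<eta> where "\<eta> = \<epsilon> / (2 * H)"
  have \<eta>: "0 < \<eta>" "\<eta> * H < \<epsilon>"
    using \<epsilon> H(1) by (auto simp: \<eta>_def)
  define E where "E = (\<lambda>i j. T $ i $ j = 1)"
  have spec: "cmod z \<le> 1 / (1 + \<eta>)"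
    if u: "u \<noteq> []" "successively E u" "E (last u) (hd u)" and z: "z \<in> complex_spectrum (word_prod A u)"
    for u z
  proof -
    have "T $ (u ! (k - 1)) $ (u ! k) = 1" if "1 \<le> k" "k < length u" for k
      using successively_nth[OF u(2), of "k - 1"] that by (simp add: E_def)
    then have periodic: "u \<in> periodic_words T (length u)"
      using u(1,3) by (simp add: periodic_words_def E_def last_conv_nth hd_conv_nth)
    have "induced_norm N (A k - (1 + \<eta>) *\<^sub>R A k) \<le> \<eta> * H" for k
    proof (rule induced_norm_le[OF N])
      fix x
      have "A k - (1 + \<eta>) *\<^sub>R A k = (- \<eta>) *\<^sub>R A k"
        by (simp add: scaleR_left_distrib)
      then have "(A k - (1 + \<eta>) *\<^sub>R A k) *v x = (- \<eta>) *\<^sub>R (A k *v x)"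
        by (simp only: scaleR_matrix_vector_assoc)
      then show "N ((A k - (1 + \<eta>) *\<^sub>R A k) *v x) \<le> \<eta> * H * N x"
        using H(2)[of k x] \<eta>(1) by (simp only: vector_normD(3)[OF N]) (simp add: mult.assoc)
    qed
    then have "specrad (word_prod (\<lambda>k. (1 + \<eta>) *\<^sub>R A k) u) < 1"
      using \<eta>(2) u(1) by (intro stable[OF _ _ periodic]) (auto intro: le_less_trans simp: Suc_le_eq)
    moreover have "of_real ((1 + \<eta>) ^ length u) * z \<in> complex_spectrum (word_prod (\<lambda>k. (1 + \<eta>) *\<^sub>R A k) u)"
      unfolding word_prod_scaleR by (rule complex_spectrum_scaleR[OF z])
    ultimately have "cmod (of_real ((1 + \<eta>) ^ length u) * z) < 1"
      unfolding specrad_less_iff by blast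
    then have "(1 + \<eta>) ^ length u * cmod z < 1"
      using \<eta>(1) by (simp only: norm_mult norm_of_real) simp
    \<comment> \<open>Only one of the factors is kept, so that the bound does not depend on the
      length of \<open>u\<close>.\<close>
    moreover have "(1 + \<eta>) ^ 1 \<le> (1 + \<eta>) ^ length u"
      using \<eta>(1) u(1) by (intro power_increasing) (auto simp: Suc_le_eq)
    then have "(1 + \<eta>) * cmod z \<le> (1 + \<eta>) ^ length u * cmod z"
      by (intro mult_right_mono) auto
    ultimately show ?thesis
      using \<eta>(1) by (simp add: field_simps)
  qed
  have l: "0 \<le> 1 / (1 + \<eta>)" "1 / (1 + \<eta>) < 1"
    using \<eta>(1) by auto
  show ?thesis
  proof (rule exponential_decay_of_periodic_spectrum[OF N l, of E A])
    fix u z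
    assume "u \<noteq> []" "successively E u" "E (last u) (hd u)" "z \<in> complex_spectrum (word_prod A u)"
    then show "cmod z \<le> 1 / (1 + \<eta>)"
      by (rule spec)
  next
    fix r C :: real
    assume r: "r > 1" "C > 0"
      and decay: "\<And>w x. successively E w \<Longrightarrow> r ^ length w * N (word_prod A w *v x) \<le> C * N x"
    \<comment> \<open>The decay rate is \<open>inverse r\<close>.\<close>
    have "induced_norm N (word_prod A (map \<sigma> [1..<n + 1])) \<le> C * inverse r ^ n"
      if "\<sigma> \<in> admissible_seqs T" for n \<sigma>
    proof (rule induced_norm_le[OF N])
      fix x
      have "successively E (map \<sigma> [1..<n + 1])"
        using that by (auto simp: successively_conv_nth admissible_seqs_def E_def simp del: upt_Suc)
      from decay[OF this, of x]
      show "N (word_prod A (map \<sigma> [1..<n + 1]) *v x) \<le> C * inverse r ^ n * N x"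
        using r(1) by (simp add: power_inverse field_simps del: upt_Suc)
    qed
    moreover have "0 < inverse r" "inverse r < 1"
      using r(1) by (simp_all add: inverse_less_1_iff)
    ultimately show ?thesis
      unfolding uniformly_exponentially_stable_def using r(2) by blast
  qed
qed

theorem theorem1p2:
  fixes N :: "real ^ 'd \<Rightarrow> real"
    and A :: "'k::finite \<Rightarrow> real ^ 'd ^ 'd"
    and T :: "nat ^ 'k ^ 'k"
  assumes "is_vector_norm N"
    and "CARD('k) \<ge> 2"
    and "\<forall>i j. T $ i $ j \<in> {0, 1}"
  shows "uniformly_exponentially_stable N A T \<longleftrightarrow> robustly_periodically_stable N A T"
  using robustly_periodically_stable_if_uniformly_exponentially_stable[OF assms(1)]
    uniformly_exponentially_stable_if_robustly_periodically_stable[OF assms(1)]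
  by blast

end
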